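(* Let $X$ be a countable, second countable topological space. If $\mathcal{M}(X)\notin\boldsymbol{\Pi}^0_1(\mathcal{P}(X))$ (i.e. $\mathcal{M}(X)$ is not closed in $\mathcal{P}(X)$), then $\mathcal{M}(X)$ is $\boldsymbol{\Sigma}^0_2$-hard.
   Context: "Countable" means countably infinite (the paper writes "at most countable" when finite sets are allowed). For a topological space $X$, a subset $A\subseteq X$ is dense in an open set $U$ if $U\subseteq\overline{A}$, and codense in $U$ if $U\subseteq\overline{X\setminus A}$. A subset $A\subseteq X$ is monitorable if for every non-empty open set $U\subseteq X$ either $A$ is not dense in $U$ or $A$ is not codense in $U$. $\mathcal{M}(X)\subseteq\mathcal{P}(X)$ denotes the family of monitorable subsets of $X$. The powerset $\mathcal{P}(X)$ is identified with $2^X$ via characteristic functions and carries the product topology (with $2=\{0,1\}$ discrete); for countable $X$ it is homeomorphic to the Cantor space. $\boldsymbol{\Sigma}^0_1(Z)$ and $\boldsymbol{\Pi}^0_1(Z)$ are the families of open and closed sets of $Z$, and $\boldsymbol{\Sigma}^0_2(Z)$ is the family of at most countable unions of closed sets of $Z$. For a boldface pointclass $\boldsymbol{\Gamma}$ and a Polish space $Z$, a set $A\subseteq Z$ is $\boldsymbol{\Gamma}$-hard if for every zero-dimensional Polish space $Y$ and every $B\in\boldsymbol{\Gamma}(Y)$ there is a continuous function $f:Y\to Z$ with $B=f^{-1}(A)$. *)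

theory Defs
  imports "HOL-Analysis.Analysis"
begin

definition dense_in :: "'a topology \<Rightarrow> 'a set \<Rightarrow> 'a set \<Rightarrow> bool"
  where "dense_in X A U \<longleftrightarrow> U \<subseteq> X closure_of A"

definition codense_in :: "'a topology \<Rightarrow> 'a set \<Rightarrow> 'a set \<Rightarrow> bool"
  where "codense_in X A U \<longleftrightarrow> U \<subseteq> X closure_of (topspace X - A)"

definition monitorable_in :: "'a topology \<Rightarrow> 'a set \<Rightarrow> bool"
  where "monitorable_in X A \<longleftrightarrow>
    A \<subseteq> topspace X \<and>
    (\<forall>U. openin X U \<and> U \<noteq> {} \<longrightarrow> \<not> dense_in X A U \<or> \<not> codense_in X A U)"

definition monitorable_sets :: "'a topology \<Rightarrow> 'a set set"
  where "monitorable_sets X = {A. monitorable_in X A}"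

text \<open>The product topology of \<open>2\<^sup>S\<close>, with \<open>2\<close> rendered as the discrete space of truth values,
  transported to the powerset of \<open>S\<close> along characteristic functions.\<close>

definition powerset_topology :: "'a set \<Rightarrow> 'a set topology"
  where "powerset_topology S =
    pullback_topology (Pow S) (\<lambda>A. \<lambda>x\<in>S. x \<in> A)
      (product_topology (\<lambda>_. discrete_topology (UNIV :: bool set)) S)"

lemma topspace_powerset_topology [simp]: "topspace (powerset_topology S) = Pow S"
  by (auto simp: powerset_topology_def topspace_pullback_topology)

lemma homeomorphic_map_powerset_topology:
  "homeomorphic_map (powerset_topology S)
     (product_topology (\<lambda>_. discrete_topology (UNIV :: bool set)) S) (\<lambda>A. \<lambda>x\<in>S. x \<in> A)"
  (is "homeomorphic_map ?P ?T ?f")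
proof -
  let ?g = "\<lambda>h. {x \<in> S. h x}"
  have fg: "?f (?g h) = h" if "h \<in> topspace ?T" for h
    using that by (auto simp: PiE_def extensional_def fun_eq_iff)
  have gf: "?g (?f A) = A" if "A \<in> topspace ?P" for A
    using that by auto
  have "continuous_map ?P ?T ?f"
    using continuous_map_pullback [OF continuous_map_id, of "Pow S" ?f ?T]
    by (simp add: powerset_topology_def o_def id_def)
  moreover have "continuous_map ?T ?P ?g"
    unfolding powerset_topology_def
  proof (rule continuous_map_pullback')
    show "continuous_map ?T ?T (?f \<circ> ?g)"
      by (rule continuous_map_eq [OF continuous_map_id]) (simp only: o_apply id_apply fg)
  qed auto
  ultimately have "homeomorphic_maps ?P ?T ?f ?g"
    using fg gf by (auto simp: homeomorphic_maps_def simp del: topspace_product_topology)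
  then show ?thesis
    by (rule homeomorphic_maps_imp_map)
qed

definition Polish_space :: "'a topology \<Rightarrow> bool"
  where "Polish_space Y \<longleftrightarrow>
    completely_metrizable_space Y \<and>
    (\<exists>D. countable D \<and> D \<subseteq> topspace Y \<and> Y closure_of D = topspace Y)"

text \<open>Zero-dimensionality in the sense of descriptive set theory: there is a base of clopen sets.
  The Hausdorff property is not included here, since it is automatic for Polish spaces.\<close>

definition zero_dimensional_space :: "'a topology \<Rightarrow> bool"
  where "zero_dimensional_space Y \<longleftrightarrow>
    (\<forall>U y. openin Y U \<and> y \<in> U \<longrightarrow>
       (\<exists>V. openin Y V \<and> closedin Y V \<and> y \<in> V \<and> V \<subseteq> U))"

text \<open>A boldface pointclass is given by its predicate \<open>\<Gamma> Y B\<close> (``\<open>B\<close> belongs to \<open>\<Gamma>(Y)\<close>'').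
  Closed sets are \<^const>\<open>closedin\<close>, and at most countable unions of closed sets are
  \<^const>\<open>fsigma_in\<close>. HOL cannot quantify over types inside a definition, so the test
  spaces \<open>Y\<close> range over all topologies with points in \<open>'b\<close>, which is determined by the type of
  \<open>\<Gamma>\<close>. A theorem concluding hardness with \<open>'b\<close> a type variable asserts it for
  test spaces over every type.\<close>

definition hard_in ::
    "('b topology \<Rightarrow> 'b set \<Rightarrow> bool) \<Rightarrow> 'a topology \<Rightarrow> 'a set \<Rightarrow> bool"
  where "hard_in \<Gamma> Z A \<longleftrightarrow>
    (\<forall>Y B. Polish_space Y \<and> zero_dimensional_space Y \<and> \<Gamma> Y B \<longrightarrow>
       (\<exists>f. continuous_map Y Z f \<and> B = {y \<in> topspace Y. f y \<in> A}))"

end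

theory Submission
  imports Defs
begin

text \<open>If every non-empty open set contains a minimal one, then a set is monitorable iff no minimal
  open set is split by it, and this is a closed condition. Otherwise some non-empty open \<open>W\<close> has no
  minimal open subset, so the points whose singleton is nowhere dense are dense in \<open>W\<close>. This
  yields pairwise disjoint finite nowhere dense sets \<open>P\<^sub>0, P\<^sub>1, \<dots> \<subseteq> W\<close> such that every non-empty
  open subset of \<open>W\<close> meets all but finitely many of them; hence a union of even-indexed \<open>P\<^sub>n\<close> is
  monitorable iff it is a finite union. In a zero-dimensional Polish space, \<open>B\<close> is an
  \<open>F\<^sub>\<sigma>\<close> iff it is the set of points that lie in only finitely many members of some sequence of clopen
  sets \<open>C\<^sub>n\<close>, and \<open>y \<mapsto> \<Union>{P\<^bsub>2n\<^esub>. y \<in> C\<^sub>n}\<close> is the reduction.\<close>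

section \<open>Monitorable sets\<close>

lemma dense_in_iff:
  assumes "openin X U"
  shows "dense_in X A U \<longleftrightarrow> (\<forall>V. openin X V \<and> V \<noteq> {} \<and> V \<subseteq> U \<longrightarrow> V \<inter> A \<noteq> {})"
proof
  assume L: "dense_in X A U"
  show "\<forall>V. openin X V \<and> V \<noteq> {} \<and> V \<subseteq> U \<longrightarrow> V \<inter> A \<noteq> {}"
  proof (intro allI impI)
    fix V assume V: "openin X V \<and> V \<noteq> {} \<and> V \<subseteq> U"
    then obtain x where "x \<in> V" by blast
    moreover have "x \<in> X closure_of A"
      using L V \<open>x \<in> V\<close> unfolding dense_in_def by blast
    ultimately show "V \<inter> A \<noteq> {}"
      using V unfolding in_closure_of by blast
  qed
next
  assume R: "\<forall>V. openin X V \<and> V \<noteq> {} \<and> V \<subseteq> U \<longrightarrow> V \<inter> A \<noteq> {}"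
  show "dense_in X A U"
    unfolding dense_in_def
  proof
    fix x assume "x \<in> U"
    have "\<exists>y. y \<in> A \<and> y \<in> T" if "x \<in> T" "openin X T" for T
    proof -
      have "(T \<inter> U) \<inter> A \<noteq> {}"
        using R that \<open>x \<in> U\<close> assms by (metis IntI Int_lower2 empty_iff openin_Int)
      then show ?thesis by blast
    qed
    then show "x \<in> X closure_of A"
      using \<open>x \<in> U\<close> assms openin_subset unfolding in_closure_of by blast
  qed
qed

text \<open>Density in \<open>U\<close> fails when some non-empty open part of \<open>U\<close>
  misses \<open>A\<close>; codensity fails when some such part lies inside \<open>A\<close>. This
  form without closures is the one all later arguments use.\<close>

lemma monitorable_in_iff:
  "monitorable_in X A \<longleftrightarrow>
    A \<subseteq> topspace X \<and>
    (\<forall>U. openin X U \<and> U \<noteq> {} \<longrightarrow>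
      (\<exists>V. openin X V \<and> V \<noteq> {} \<and> V \<subseteq> U \<and> (V \<inter> A = {} \<or> V \<subseteq> A)))"
proof -
  have "V \<inter> (topspace X - A) = {} \<longleftrightarrow> V \<subseteq> A" if "openin X V" for V
    using openin_subset [OF that] by blast
  then have "(\<not> dense_in X A U \<or> \<not> codense_in X A U) \<longleftrightarrow>
      (\<exists>V. openin X V \<and> V \<noteq> {} \<and> V \<subseteq> U \<and> (V \<inter> A = {} \<or> V \<subseteq> A))" if "openin X U" for U
    using dense_in_iff [OF that, of A] dense_in_iff [OF that, of "topspace X - A"]
    unfolding codense_in_def dense_in_def by blast
  then show ?thesis
    unfolding monitorable_in_def by blast
qed

section \<open>The powerset topology\<close>

lemma continuous_map_discrete_bool_iff:
  "continuous_map Y (discrete_topology (UNIV :: bool set)) p \<longleftrightarrow>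
    openin Y {y \<in> topspace Y. p y} \<and> closedin Y {y \<in> topspace Y. p y}"
  (is "?L \<longleftrightarrow> ?R")
proof
  assume c: ?L
  have "{y \<in> topspace Y. p y} = {y \<in> topspace Y. p y \<in> {True}}" by auto
  then show ?R
    using openin_continuous_map_preimage [OF c, of "{True}"]
      closedin_continuous_map_preimage [OF c, of "{True}"] by simp
next
  assume R: ?R
  have "openin Y {y \<in> topspace Y. p y \<in> T}" for T :: "bool set"
  proof -
    let ?P = "{y \<in> topspace Y. p y}"
    have "{y \<in> topspace Y. p y \<in> T} =
        (if True \<in> T then ?P else {}) \<union> (if False \<in> T then topspace Y - ?P else {})"
      by (cases "True \<in> T"; cases "False \<in> T") (auto, (metis (full_types))+)
    then show ?thesis
      using R by (auto intro: openin_Un)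
  qed
  then show ?L
    by (simp add: continuous_map_def)
qed

text \<open>Continuity into a product is checked coordinatewise, and a map into the discrete space
  of truth values is continuous exactly when its truth set is clopen.\<close>

lemma continuous_map_powerset_topology:
  assumes "\<And>y. y \<in> topspace Y \<Longrightarrow> f y \<subseteq> S"
    and "\<And>x. x \<in> S \<Longrightarrow> openin Y {y \<in> topspace Y. x \<in> f y}"
    and "\<And>x. x \<in> S \<Longrightarrow> closedin Y {y \<in> topspace Y. x \<in> f y}"
  shows "continuous_map Y (powerset_topology S) f"
  unfolding powerset_topology_def
proof (rule continuous_map_pullback')
  show "continuous_map Y (product_topology (\<lambda>_. discrete_topology (UNIV :: bool set)) S)
      ((\<lambda>A. \<lambda>x\<in>S. x \<in> A) \<circ> f)"
    using assms(2,3)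
    by (auto simp: continuous_map_componentwise continuous_map_discrete_bool_iff)
  show "topspace Y \<subseteq> f -` Pow S"
    using assms(1) by auto
qed

lemma
  assumes "x \<in> S"
  shows openin_powerset_topology_mem: "openin (powerset_topology S) {A \<in> Pow S. x \<in> A}"
    and closedin_powerset_topology_mem: "closedin (powerset_topology S) {A \<in> Pow S. x \<in> A}"
proof -
  have "continuous_map (powerset_topology S) (discrete_topology (UNIV :: bool set))
      ((\<lambda>h. h x) \<circ> (\<lambda>A. \<lambda>x\<in>S. x \<in> A))"
    using continuous_map_product_projection [OF assms] homeomorphic_map_powerset_topology
    by (blast intro: continuous_map_compose homeomorphic_imp_continuous_map)
  then have "continuous_map (powerset_topology S) (discrete_topology (UNIV :: bool set))
      (\<lambda>A. x \<in> A)"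
    using assms by (simp add: o_def)
  then show "openin (powerset_topology S) {A \<in> Pow S. x \<in> A}"
    and "closedin (powerset_topology S) {A \<in> Pow S. x \<in> A}"
    by (simp_all add: continuous_map_discrete_bool_iff)
qed

text \<open>Agreement of two coordinates means both hold or both fail, and each coordinate condition
  is clopen.\<close>

lemma closedin_powerset_topology_mem_eq:
  assumes "x \<in> S" "y \<in> S"
  shows "closedin (powerset_topology S) {A \<in> Pow S. x \<in> A \<longleftrightarrow> y \<in> A}"
proof -
  let ?M = "\<lambda>x. {A \<in> Pow S. x \<in> A}"
  have "closedin (powerset_topology S) (Pow S - ?M z)" if "z \<in> S" for z
    using openin_powerset_topology_mem [OF that]
    by (metis closedin_topspace closedin_diff topspace_powerset_topology)
  then have "closedin (powerset_topology S)
      ((?M x \<inter> ?M y) \<union> ((Pow S - ?M x) \<inter> (Pow S - ?M y)))"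
    using assms closedin_powerset_topology_mem by (intro closedin_Un closedin_Int) auto
  also have "(?M x \<inter> ?M y) \<union> ((Pow S - ?M x) \<inter> (Pow S - ?M y)) = {A \<in> Pow S. x \<in> A \<longleftrightarrow> y \<in> A}"
    by auto
  finally show ?thesis .
qed

section \<open>Minimal open sets\<close>

definition minimal_openin :: "'a topology \<Rightarrow> 'a set \<Rightarrow> bool"
  where "minimal_openin X M \<longleftrightarrow>
    openin X M \<and> M \<noteq> {} \<and> (\<forall>V. openin X V \<and> V \<noteq> {} \<and> V \<subseteq> M \<longrightarrow> V = M)"

text \<open>The only non-empty open subset of a minimal \<open>M\<close> is \<open>M\<close> itself,
  so \<open>A\<close> must contain or miss all of it. Conversely, a minimal open set inside
  \<open>U\<close> is the witness that monitorability asks for.\<close>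

lemma monitorable_in_iff_minimal:
  assumes "\<And>U. openin X U \<Longrightarrow> U \<noteq> {} \<Longrightarrow> \<exists>M. minimal_openin X M \<and> M \<subseteq> U"
  shows "monitorable_in X A \<longleftrightarrow>
    A \<subseteq> topspace X \<and> (\<forall>M. minimal_openin X M \<longrightarrow> (\<forall>x\<in>M. \<forall>y\<in>M. x \<in> A \<longleftrightarrow> y \<in> A))"
  (is "?L \<longleftrightarrow> ?R")
proof
  assume ?L
  then show ?R
    unfolding monitorable_in_iff minimal_openin_def by blast
next
  assume R: ?R
  have "\<exists>V. openin X V \<and> V \<noteq> {} \<and> V \<subseteq> U \<and> (V \<inter> A = {} \<or> V \<subseteq> A)"
    if U: "openin X U" "U \<noteq> {}" for U
  proof -
    obtain M where M: "minimal_openin X M" "M \<subseteq> U"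
      using assms [OF U] by blast
    then have "M \<inter> A = {} \<or> M \<subseteq> A"
      using R by blast
    then show ?thesis
      using M unfolding minimal_openin_def by blast
  qed
  then show ?L
    using R unfolding monitorable_in_iff by blast
qed

lemma closedin_monitorable_sets:
  assumes "\<And>U. openin X U \<Longrightarrow> U \<noteq> {} \<Longrightarrow> \<exists>M. minimal_openin X M \<and> M \<subseteq> U"
  shows "closedin (powerset_topology (topspace X)) (monitorable_sets X)"
proof -
  \<comment> \<open>Not splitting a minimal open set is a condition on pairs of its points, so
    monitorability becomes an intersection of two-coordinate conditions.\<close>
  define I where "I = {(x, y). \<exists>M. minimal_openin X M \<and> x \<in> M \<and> y \<in> M}"
  let ?E = "\<lambda>(x, y). {A \<in> Pow (topspace X). x \<in> A \<longleftrightarrow> y \<in> A}"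
  have I: "x \<in> topspace X" "y \<in> topspace X" if "(x, y) \<in> I" for x y
    using that openin_subset unfolding I_def minimal_openin_def by blast+
  \<comment> \<open>Inserting the whole powerset keeps the intersected family non-empty when
    \<open>I\<close> is empty.\<close>
  have "A \<in> monitorable_sets X \<longleftrightarrow> A \<in> \<Inter> (insert (Pow (topspace X)) (?E ` I))" for A
  proof -
    have "monitorable_in X A \<longleftrightarrow>
        A \<subseteq> topspace X \<and> (\<forall>M. minimal_openin X M \<longrightarrow> (\<forall>x\<in>M. \<forall>y\<in>M. x \<in> A \<longleftrightarrow> y \<in> A))"
      by (intro monitorable_in_iff_minimal assms)
    then have "A \<in> monitorable_sets X \<longleftrightarrow>
        A \<subseteq> topspace X \<and> (\<forall>(x, y)\<in>I. x \<in> A \<longleftrightarrow> y \<in> A)"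
      unfolding monitorable_sets_def I_def by auto
    also have "\<dots> \<longleftrightarrow> A \<in> \<Inter> (insert (Pow (topspace X)) (?E ` I))"
      by auto
    finally show ?thesis .
  qed
  then have "monitorable_sets X = \<Inter> (insert (Pow (topspace X)) (?E ` I))"
    by blast
  moreover have "closedin (powerset_topology (topspace X))
      (\<Inter> (insert (Pow (topspace X)) (?E ` I)))"
  proof (rule closedin_Inter)
    show "closedin (powerset_topology (topspace X)) K"
      if K: "K \<in> insert (Pow (topspace X)) (?E ` I)" for K
    proof (cases "K = Pow (topspace X)")
      case True
      then show ?thesis
        by (metis closedin_topspace topspace_powerset_topology)
    next
      case False
      then obtain x y where "(x, y) \<in> I" "K = {A \<in> Pow (topspace X). x \<in> A \<longleftrightarrow> y \<in> A}"
        using K by auto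
      then show ?thesis
        using closedin_powerset_topology_mem_eq [of x "topspace X" y] I by simp
    qed
  qed simp
  ultimately show ?thesis
    by simp
qed

section \<open>Nowhere dense sets\<close>

text \<open>Equivalent to the closure of \<open>A\<close> having empty interior; this form allows
  repeated shrinking of open sets.\<close>

definition nowhere_dense_in :: "'a topology \<Rightarrow> 'a set \<Rightarrow> bool"
  where "nowhere_dense_in X A \<longleftrightarrow>
    (\<forall>U. openin X U \<and> U \<noteq> {} \<longrightarrow> (\<exists>V. openin X V \<and> V \<noteq> {} \<and> V \<subseteq> U \<and> V \<inter> A = {}))"

lemma nowhere_dense_in_empty: "nowhere_dense_in X {}"
  unfolding nowhere_dense_in_def by auto

lemma nowhere_dense_in_Un:
  assumes "nowhere_dense_in X A" "nowhere_dense_in X B"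
  shows "nowhere_dense_in X (A \<union> B)"
  unfolding nowhere_dense_in_def
proof (intro allI impI)
  fix U assume "openin X U \<and> U \<noteq> {}"
  then obtain V where V: "openin X V" "V \<noteq> {}" "V \<subseteq> U" "V \<inter> A = {}"
    using assms(1) unfolding nowhere_dense_in_def by blast
  then obtain V' where "openin X V'" "V' \<noteq> {}" "V' \<subseteq> V" "V' \<inter> B = {}"
    using assms(2) unfolding nowhere_dense_in_def by meson
  with V show "\<exists>V. openin X V \<and> V \<noteq> {} \<and> V \<subseteq> U \<and> V \<inter> (A \<union> B) = {}"
    by (intro exI [of _ V']) blast
qed

lemma nowhere_dense_in_subset:
  "nowhere_dense_in X A \<Longrightarrow> B \<subseteq> A \<Longrightarrow> nowhere_dense_in X B"
  unfolding nowhere_dense_in_def by (meson disjoint_iff subset_iff)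

lemma nowhere_dense_in_finite:
  assumes "finite A" "\<And>x. x \<in> A \<Longrightarrow> nowhere_dense_in X {x}"
  shows "nowhere_dense_in X A"
  using assms
proof (induction A)
  case (insert x A)
  then show ?case
    using nowhere_dense_in_Un [of X "{x}" A] by simp
qed (rule nowhere_dense_in_empty)

lemma nowhere_dense_in_imp_monitorable_in:
  "nowhere_dense_in X A \<Longrightarrow> A \<subseteq> topspace X \<Longrightarrow> monitorable_in X A"
  unfolding nowhere_dense_in_def monitorable_in_iff by meson

text \<open>If no point of \<open>U\<close> is nowhere dense, each \<open>x\<close> in
  \<open>U\<close> has a non-empty open \<open>W x\<close> all of whose non-empty open subsets
  contain \<open>x\<close>. Then \<open>W x \<inter> U\<close> is minimal open, a
  contradiction.\<close>

lemma ex_nowhere_dense_point: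
  assumes U: "openin X U" "U \<noteq> {}" and no_min: "\<And>M. minimal_openin X M \<Longrightarrow> \<not> M \<subseteq> U"
  shows "\<exists>x\<in>U. nowhere_dense_in X {x}"
proof (rule ccontr)
  assume "\<not> ?thesis"
  then have "\<forall>x\<in>U. \<exists>W. openin X W \<and> W \<noteq> {} \<and> (\<forall>V. openin X V \<and> V \<noteq> {} \<and> V \<subseteq> W \<longrightarrow> x \<in> V)"
    by (simp add: nowhere_dense_in_def) meson
  then obtain W where W: "\<And>x. x \<in> U \<Longrightarrow> openin X (W x)" "\<And>x. x \<in> U \<Longrightarrow> W x \<noteq> {}"
    and mem: "\<And>x V. x \<in> U \<Longrightarrow> openin X V \<Longrightarrow> V \<noteq> {} \<Longrightarrow> V \<subseteq> W x \<Longrightarrow> x \<in> V"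
    by metis
  obtain x where x: "x \<in> U"
    using U by blast
  have self: "y \<in> W y" if "y \<in> U" for y
    using W mem that by blast
  have "minimal_openin X (W x \<inter> U)"
    unfolding minimal_openin_def
  proof (intro conjI allI impI)
    show "openin X (W x \<inter> U)" "W x \<inter> U \<noteq> {}"
      using W U x self by auto
    fix V assume V: "openin X V \<and> V \<noteq> {} \<and> V \<subseteq> W x \<inter> U"
    have "y \<in> V" if y: "y \<in> W x \<inter> U" for y
    proof -
      have "x \<in> V"
        using mem [OF x, of V] V by blast
      \<comment> \<open>This set is a non-empty open subset of \<open>W x\<close>, as it contains
        \<open>y\<close>. Hence \<open>x\<close> lies in both \<open>W y\<close> and
        \<open>V\<close>, so \<open>W y \<inter> V\<close> is a non-empty open subset of
        \<open>W y\<close> and must contain \<open>y\<close>.\<close>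
      moreover have "x \<in> W y \<inter> (W x \<inter> U)"
        using y self U W x by (intro mem [OF x]) (auto simp: openin_Int)
      ultimately show ?thesis
        using mem [of y "W y \<inter> V"] y V W(1) by (metis IntD1 IntD2 Int_iff Int_lower1 empty_iff openin_Int)
    qed
    then show "V = W x \<inter> U"
      using V by blast
  qed
  then show False
    using no_min by blast
qed

text \<open>The disjoint sets of the construction are the layers \<open>S (Suc n) - S n\<close>. A
  base of the open subsets of \<open>W\<close> is enumerated as \<open>v\<close>, and layer
  \<open>n\<close> is made to meet \<open>v 0\<close>, ..., \<open>v n\<close>.\<close>

lemma ex_increasing_finite_nowhere_dense:
  assumes X: "second_countable X" and W: "openin X W" "W \<noteq> {}"
    and no_min: "\<And>M. minimal_openin X M \<Longrightarrow> \<not> M \<subseteq> W"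
  obtains S where "mono S" "\<And>n :: nat. S n \<subseteq> W" "\<And>n. nowhere_dense_in X (S n)"
    "\<And>V. openin X V \<Longrightarrow> V \<noteq> {} \<Longrightarrow> V \<subseteq> W \<Longrightarrow> \<exists>k. \<forall>n\<ge>k. V \<inter> (S (Suc n) - S n) \<noteq> {}"
proof -
  define N where "N = {x \<in> W. nowhere_dense_in X {x}}"
  obtain \<B> where \<B>: "countable \<B>" "\<And>V. V \<in> \<B> \<Longrightarrow> openin X V"
    "\<And>U x. openin X U \<Longrightarrow> x \<in> U \<Longrightarrow> \<exists>V\<in>\<B>. x \<in> V \<and> V \<subseteq> U"
    using X unfolding second_countable_def by metis
  define \<B>' where "\<B>' = {V \<in> \<B>. V \<noteq> {} \<and> V \<subseteq> W}"
  have \<B>': "\<exists>V\<in>\<B>'. V \<subseteq> U" if "openin X U" "U \<noteq> {}" "U \<subseteq> W" for U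
  proof -
    obtain x where "x \<in> U"
      using \<open>U \<noteq> {}\<close> by blast
    then obtain V where "V \<in> \<B>" "x \<in> V" "V \<subseteq> U"
      using \<B>(3) \<open>openin X U\<close> by meson
    then show ?thesis
      using \<open>U \<subseteq> W\<close> unfolding \<B>'_def by blast
  qed
  have "countable \<B>'" "\<B>' \<noteq> {}"
    using \<B>(1) \<B>' [OF W] unfolding \<B>'_def by auto
  then obtain v :: "nat \<Rightarrow> 'a set" where v: "range v = \<B>'"
    by (metis range_from_nat_into)
  have v': "openin X (v k)" "v k \<noteq> {}" "v k \<subseteq> W" for k
    using v \<B>(2) unfolding \<B>'_def by blast+
  let ?P = "\<lambda>S. finite S \<and> S \<subseteq> N"
  have nd: "nowhere_dense_in X S" if "?P S" for S
    using that by (auto intro: nowhere_dense_in_finite simp: N_def)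
  \<comment> \<open>A finite set of nowhere dense points is nowhere dense, so \<open>v k\<close> has
    a non-empty open part avoiding it; that part contains no minimal open set and so yields a fresh
    point.\<close>
  have new: "\<exists>x\<in>N. x \<in> v k \<and> x \<notin> S" if S: "?P S" for S k
  proof -
    obtain V where V: "openin X V" "V \<noteq> {}" "V \<subseteq> v k" "V \<inter> S = {}"
      using nd [OF S] v'(1,2) [of k] unfolding nowhere_dense_in_def by meson
    moreover have "\<not> M \<subseteq> V" if "minimal_openin X M" for M
      using no_min [OF that] V(3) v'(3) by blast
    ultimately obtain x where "x \<in> V" "nowhere_dense_in X {x}"
      using ex_nowhere_dense_point by metis
    then show ?thesis
      using V v'(3) unfolding N_def by blast
  qed
  \<comment> \<open>Only the indices up to \<open>n\<close> are served at stage \<open>n\<close>,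
    which keeps \<open>T\<close> finite.\<close>
  have step: "\<exists>T. ?P T \<and> S \<subseteq> T \<and> (\<forall>k\<le>n. v k \<inter> (T - S) \<noteq> {})" if S: "?P S" for S and n :: nat
  proof -
    obtain a where a: "\<And>k. a k \<in> N \<and> a k \<in> v k \<and> a k \<notin> S"
      using new [OF S] by metis
    have "a k \<in> v k \<inter> ((S \<union> a ` {..n}) - S)" if "k \<le> n" for k
      using a that by auto
    moreover have "?P (S \<union> a ` {..n})"
      using S a by auto
    ultimately show ?thesis
      by (intro exI [of _ "S \<union> a ` {..n}"]) blast
  qed
  obtain S where S: "\<And>n. ?P (S n)" "\<And>n. S n \<subseteq> S (Suc n)"
    "\<And>n k. k \<le> n \<Longrightarrow> v k \<inter> (S (Suc n) - S n) \<noteq> {}"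
    using dependent_nat_choice [of "\<lambda>_. ?P" "\<lambda>n S T. S \<subseteq> T \<and> (\<forall>k\<le>n. v k \<inter> (T - S) \<noteq> {})"] step
    by (metis empty_subsetI finite.emptyI)
  show thesis
  proof (rule that)
    show "mono S"
      using S(2) by (simp add: mono_iff_le_Suc)
    show "S n \<subseteq> W" "nowhere_dense_in X (S n)" for n
      using S(1) nd unfolding N_def by blast+
    fix V assume "openin X V" "V \<noteq> {}" "V \<subseteq> W"
    then obtain k where "v k \<subseteq> V"
      using \<B>' v by blast
    then show "\<exists>k. \<forall>n\<ge>k. V \<inter> (S (Suc n) - S n) \<noteq> {}"
      using S(3) by blast
  qed
qed

text \<open>A finite union of layers lies in a single \<open>S (2 * m)\<close> and is nowhere dense.
  For infinite \<open>I\<close>, every non-empty open subset of \<open>W\<close> meets both a layer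
  in the union and an odd layer, and the odd layers are always left out.\<close>

lemma monitorable_in_Union_layers_iff:
  assumes "mono S" and S: "\<And>n :: nat. S n \<subseteq> W" "\<And>n. nowhere_dense_in X (S n)"
    and W: "openin X W" "W \<noteq> {}"
    and meets: "\<And>V. openin X V \<Longrightarrow> V \<noteq> {} \<Longrightarrow> V \<subseteq> W \<Longrightarrow> \<exists>k. \<forall>n\<ge>k. V \<inter> (S (Suc n) - S n) \<noteq> {}"
  shows "monitorable_in X (\<Union>n\<in>I. S (Suc (2 * n)) - S (2 * n)) \<longleftrightarrow> finite I"
    (is "monitorable_in X ?A \<longleftrightarrow> _")
proof
  assume "finite I"
  then obtain m where m: "\<And>n. n \<in> I \<Longrightarrow> n < m"
    using finite_nat_set_iff_bounded by metis
  have "?A \<subseteq> S (2 * m)"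
  proof
    fix x assume "x \<in> ?A"
    then obtain n where "n \<in> I" "x \<in> S (Suc (2 * n))"
      by blast
    then show "x \<in> S (2 * m)"
      using monoD [OF \<open>mono S\<close>, of "Suc (2 * n)" "2 * m"] m [of n] by auto
  qed
  moreover have "S (2 * m) \<subseteq> topspace X"
    using S(1) openin_subset [OF W(1)] by blast
  ultimately show "monitorable_in X ?A"
    by (meson S(2) nowhere_dense_in_subset nowhere_dense_in_imp_monitorable_in order_trans)
next
  assume "monitorable_in X ?A"
  then obtain V where V: "openin X V" "V \<noteq> {}" "V \<subseteq> W" "V \<inter> ?A = {} \<or> V \<subseteq> ?A"
    using W unfolding monitorable_in_iff by meson
  obtain k where k: "\<And>n. n \<ge> k \<Longrightarrow> V \<inter> (S (Suc n) - S n) \<noteq> {}"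
    using meets [OF V(1-3)] by blast
  have "\<not> V \<subseteq> ?A"
  proof -
    \<comment> \<open>A point of \<open>V\<close> in the odd layer \<open>Suc (2 * k)\<close>, whose
      index is at least \<open>k\<close>.\<close>
    obtain x where x: "x \<in> V" "x \<in> S (Suc (Suc (2 * k)))" "x \<notin> S (Suc (2 * k))"
      using k [of "Suc (2 * k)"] by auto
    have "x \<notin> S (Suc (2 * n)) - S (2 * n)" for n
    proof (cases "n \<le> k")
      case True
      then show ?thesis
        using x(3) monoD [OF \<open>mono S\<close>, of "Suc (2 * n)" "Suc (2 * k)"] by auto
    next
      case False
      then show ?thesis
        using x(2) monoD [OF \<open>mono S\<close>, of "Suc (Suc (2 * k))" "2 * n"] by auto
    qed
    then show ?thesis
      using x(1) by blast
  qed
  then have "V \<inter> ?A = {}"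
    using V(4) by blast
  \<comment> \<open>For \<open>n \<ge> k\<close> also \<open>2 * n \<ge> k\<close>, so layer
    \<open>2 * n\<close> would meet \<open>V\<close> and, being part of the union, contradict
    disjointness.\<close>
  then have "n < k" if "n \<in> I" for n
    using that k [of "2 * n"] by (cases "k \<le> n") auto
  then show "finite I"
    using finite_nat_set_iff_bounded by metis
qed

section \<open>Zero-dimensional Polish spaces\<close>

text \<open>The balls of radius \<open>1 / (n + 1)\<close> around points of the countable dense set
  form a base.\<close>

lemma (in Metric_space) second_countable_mtopology:
  assumes D: "countable D" "D \<subseteq> M" "mtopology closure_of D = M"
  shows "second_countable mtopology"
  unfolding second_countable_def
proof (intro exI conjI ballI allI impI)
  let ?\<B> = "(\<lambda>(d, n). mball d (inverse (real (Suc n)))) ` (D \<times> UNIV)"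
  show "countable ?\<B>"
    using D(1) by blast
  show "openin mtopology V" if "V \<in> ?\<B>" for V
    using that by auto
  fix U x assume "openin mtopology U \<and> x \<in> U"
  then obtain r where x: "x \<in> M" and r: "r > 0" "mball x r \<subseteq> U"
    unfolding openin_mtopology by blast
  \<comment> \<open>Half of \<open>r\<close> suffices: the ball around \<open>p\<close> is to
    contain \<open>x\<close> and stay within distance \<open>r\<close> of it.\<close>
  obtain n where n: "inverse (real (Suc n)) < r / 2"
    using reals_Archimedean [of "r / 2"] r(1) by auto
  let ?e = "inverse (real (Suc n))"
  have "x \<in> mtopology closure_of D"
    using x D(3) by simp
  moreover have "?e > 0"
    by simp
  ultimately obtain p where p: "p \<in> D" "p \<in> mball x ?e"
    unfolding metric_closure_of mem_Collect_eq by blast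
  have "mball p ?e \<subseteq> mball x r"
  proof
    fix y assume "y \<in> mball p ?e"
    then show "y \<in> mball x r"
      using p n triangle [of x p y] by (auto simp: commute)
  qed
  moreover have "x \<in> mball p ?e"
    using p by (simp add: commute)
  ultimately show "\<exists>V\<in>?\<B>. x \<in> V \<and> V \<subseteq> U"
    using p(1) r(2) by (intro bexI [of _ "mball p ?e"]) auto
qed

lemma Polish_space_imp_second_countable:
  assumes "Polish_space Y"
  shows "second_countable Y"
proof -
  obtain D where D: "countable D" "D \<subseteq> topspace Y" "Y closure_of D = topspace Y"
    using assms unfolding Polish_space_def by blast
  have "metrizable_space Y"
    using assms completely_metrizable_imp_metrizable_space unfolding Polish_space_def by blast
  then obtain M d where "Metric_space M d" and Y: "Y = Metric_space.mtopology M d"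
    unfolding metrizable_space_def by blast
  then interpret Metric_space M d
    by simp
  show ?thesis
    using second_countable_mtopology [of D] D by (simp add: Y)
qed

text \<open>Clopen subsets cover \<open>G\<close>, the Lindelof property leaves countably many, and
  removing from each the finitely many earlier ones keeps them clopen while making them
  disjoint.\<close>

lemma open_eq_disjoint_Union_clopen:
  assumes Y: "second_countable Y" "zero_dimensional_space Y" and G: "openin Y G"
  obtains C where "\<And>k :: nat. openin Y (C k)" "\<And>k. closedin Y (C k)" "disjoint_family C"
    "(\<Union>k. C k) = G"
proof -
  define \<U> where "\<U> = {V. openin Y V \<and> closedin Y V \<and> V \<subseteq> G}"
  have cov: "G \<subseteq> \<Union>\<U>"
    using Y(2) G unfolding zero_dimensional_space_def \<U>_def by blast
  have "Lindelof_space (subtopology Y G)"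
    using Y(1) second_countable_subtopology second_countable_imp_Lindelof_space by blast
  then obtain \<V> where \<V>: "countable \<V>" "\<V> \<subseteq> \<U>" "G \<subseteq> \<Union>\<V>"
    using cov openin_subset [OF G]
    unfolding Lindelof_space_subtopology_subset [OF openin_subset [OF G]] \<U>_def
    by (smt (verit, best) mem_Collect_eq)
  \<comment> \<open>The empty set is added so that an enumeration by the naturals exists even for an
    empty cover.\<close>
  have "insert {} \<V> \<noteq> {}" "countable (insert {} \<V>)"
    using \<V>(1) by auto
  then obtain E :: "nat \<Rightarrow> _" where E: "range E = insert {} \<V>"
    by (metis range_from_nat_into)
  have "E k \<in> \<U>" for k
    using E \<V>(2) unfolding \<U>_def by (metis (no_types, lifting) closedin_empty empty_subsetI
        insertE mem_Collect_eq openin_empty rangeI subsetD)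
  then have clopen: "openin Y (E k)" "closedin Y (E k)" "E k \<subseteq> G" for k
    unfolding \<U>_def by auto
  show thesis
  proof (rule that [of "disjointed E"])
    show "openin Y (disjointed E k)" "closedin Y (disjointed E k)" for k
      unfolding disjointed_def using clopen
      by (auto intro!: openin_diff closedin_diff closedin_Union openin_Union)
    show "(\<Union>k. disjointed E k) = G"
    proof
      show "(\<Union>k. disjointed E k) \<subseteq> G"
        unfolding UN_disjointed_eq using clopen(3) by (rule UN_least)
      show "G \<subseteq> (\<Union>k. disjointed E k)"
        unfolding UN_disjointed_eq E using \<V>(3) by simp
    qed
  qed (rule disjoint_family_disjointed)
qed

text \<open>With \<open>B\<close> an increasing union of closed \<open>F n\<close>, each complement
  of \<open>F n\<close> splits into disjoint clopen sets \<open>D n k\<close>. A point lies in at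
  most one \<open>D n k\<close> for each \<open>n\<close>, and in one exactly when it is outside
  \<open>F n\<close>. So it lies in finitely many altogether iff it belongs to some
  \<open>F m\<close>, and hence to all later ones.\<close>

lemma fsigma_in_eq_finitely_often_clopen:
  assumes Y: "second_countable Y" "zero_dimensional_space Y" and B: "fsigma_in Y B"
  obtains C where "\<And>n :: nat. openin Y (C n)" "\<And>n. closedin Y (C n)"
    "B = {y \<in> topspace Y. finite {n. y \<in> C n}}"
proof -
  obtain F where F: "\<And>n :: nat. closedin Y (F n)" "\<And>n. F n \<subseteq> F (Suc n)" "\<Union> (range F) = B"
    using B unfolding fsigma_in_ascending by blast
  have memB: "y \<in> B \<longleftrightarrow> (\<exists>n. y \<in> F n)" for y
    unfolding F(3) [symmetric] by simp
  have "mono F"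
    using F(2) by (simp add: mono_iff_le_Suc)
  have "\<exists>D. (\<forall>k :: nat. openin Y (D k) \<and> closedin Y (D k)) \<and> disjoint_family D \<and>
      (\<Union>k. D k) = topspace Y - F n" for n
    using open_eq_disjoint_Union_clopen [OF Y, of "topspace Y - F n"] F(1)
    by (metis openin_closedin_eq closedin_def)
  then obtain D where D: "\<And>n k :: nat. openin Y (D n k)" "\<And>n k. closedin Y (D n k)"
    "\<And>n. disjoint_family (D n)" "\<And>n. (\<Union>k. D n k) = topspace Y - F n"
    by metis
  have memD: "(\<exists>k. y \<in> D n k) \<longleftrightarrow> y \<in> topspace Y - F n" for y n
    unfolding D(4) [symmetric] by simp
  \<comment> \<open>The double family becomes a single sequence; since \<open>prod_decode\<close> is
    a bijection, finiteness of the index set is preserved.\<close>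
  define C where "C i = case_prod D (prod_decode i)" for i
  have fin: "finite {i. y \<in> C i} \<longleftrightarrow> finite {(n, k). y \<in> D n k}" for y
  proof -
    have "{i. y \<in> C i} = prod_decode -` {(n, k). y \<in> D n k}"
      by (auto simp: C_def split: prod.splits)
    then show ?thesis
      by (simp only: finite_vimage_iff [OF bij_prod_decode])
  qed
  have "finite {(n, k). y \<in> D n k}" if y: "y \<in> B" for y
  proof -
    obtain m where m: "y \<in> F m"
      using y memB [of y] by blast
    have "n < m" if "y \<in> D n k" for n k
    proof -
      have "y \<notin> F n"
        using memD [of y n] that by blast
      then show ?thesis
        using m monoD [OF \<open>mono F\<close>, of m n] by (metis not_le subsetD)
    qed
    then have "{(n, k). y \<in> D n k} \<subseteq> (SIGMA n:{..<m}. {k. y \<in> D n k})"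
      by auto
    moreover have "finite {k. y \<in> D n k}" for n
    proof -
      have "{k. y \<in> D n k} \<subseteq> {k}" if "y \<in> D n k" for k
        using that D(3) [of n] unfolding disjoint_family_on_def by blast
      then show ?thesis
        by (metis (mono_tags, lifting) finite.emptyI finite_insert finite_subset empty_Collect_eq)
    qed
    ultimately show ?thesis
      by (meson finite_SigmaI finite_lessThan finite_subset)
  qed
  moreover have "infinite {(n, k). y \<in> D n k}" if "y \<in> topspace Y" "y \<notin> B" for y
  proof
    assume "finite {(n, k). y \<in> D n k}"
    \<comment> \<open>A point outside \<open>B\<close> avoids every \<open>F n\<close>, so every
      \<open>n\<close> occurs as a first component.\<close>
    moreover have "fst ` {(n, k). y \<in> D n k} = UNIV"
    proof -
      have "\<exists>k. y \<in> D n k" for n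
        using that unfolding memD memB by blast
      then show ?thesis
        by (force simp: image_iff)
    qed
    ultimately show False
      by (metis finite_imageI infinite_UNIV_nat)
  qed
  ultimately have "B = {y \<in> topspace Y. finite {i. y \<in> C i}}"
    using fsigma_in_subset [OF B] fin by blast
  moreover have "openin Y (C i)" "closedin Y (C i)" for i
    using D(1,2) by (simp_all add: C_def split: prod.split)
  ultimately show thesis
    using that by blast
qed

section \<open>The continuous reduction\<close>

theorem theorem3p4:
  fixes X :: "'a topology"
  assumes "countable (topspace X)" and "infinite (topspace X)"
    and "second_countable X"
    and "\<not> closedin (powerset_topology (topspace X)) (monitorable_sets X)"
  shows "hard_in (fsigma_in :: 'b topology \<Rightarrow> 'b set \<Rightarrow> bool)
           (powerset_topology (topspace X)) (monitorable_sets X)"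
proof -
  \<comment> \<open>If every non-empty open set contained a minimal one,
    \<open>monitorable_sets X\<close> would be closed.\<close>
  obtain W where W: "openin X W" "W \<noteq> {}" and no_min: "\<And>M. minimal_openin X M \<Longrightarrow> \<not> M \<subseteq> W"
    using closedin_monitorable_sets assms(4) by metis
  obtain S where S: "mono S" "\<And>n :: nat. S n \<subseteq> W" "\<And>n. nowhere_dense_in X (S n)"
    and meets: "\<And>V. openin X V \<Longrightarrow> V \<noteq> {} \<Longrightarrow> V \<subseteq> W \<Longrightarrow> \<exists>k. \<forall>n\<ge>k. V \<inter> (S (Suc n) - S n) \<noteq> {}"
    using ex_increasing_finite_nowhere_dense [OF assms(3) W no_min] by metis
  show ?thesis
    unfolding hard_in_def
  proof (intro allI impI)
    fix Y :: "'b topology" and B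
    assume "Polish_space Y \<and> zero_dimensional_space Y \<and> fsigma_in Y B"
    then have "second_countable Y" "zero_dimensional_space Y" "fsigma_in Y B"
      using Polish_space_imp_second_countable by blast+
    then obtain C where C: "\<And>n :: nat. openin Y (C n)" "\<And>n. closedin Y (C n)"
      and B: "B = {y \<in> topspace Y. finite {n. y \<in> C n}}"
      by (rule fsigma_in_eq_finitely_often_clopen) (rule that)
    define f where "f y = (\<Union>n\<in>{n. y \<in> C n}. S (Suc (2 * n)) - S (2 * n))" for y
    have "continuous_map Y (powerset_topology (topspace X)) f"
    proof (rule continuous_map_powerset_topology)
      show "f y \<subseteq> topspace X" for y
        using S(2) openin_subset [OF W(1)] unfolding f_def by blast
      fix x
      let ?J = "{n. x \<in> S (Suc (2 * n)) - S (2 * n)}"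
      have eq: "{y \<in> topspace Y. x \<in> f y} = \<Union> (C ` ?J)"
        using openin_subset [OF C(1)] unfolding f_def by blast
      \<comment> \<open>Finiteness makes the union of the clopen \<open>C n\<close> closed as well
        as open. Once \<open>x\<close> is in \<open>S m\<close>, it is in \<open>S (2 * n)\<close>
        for all \<open>n > m\<close>, so no such layer contains it.\<close>
      have "finite ?J"
      proof (cases "\<exists>m. x \<in> S m")
        case True
        then obtain m where m: "x \<in> S m" ..
        have "n \<le> m" if "n \<in> ?J" for n
          using that m monoD [OF S(1), of m "2 * n"] by (cases "n \<le> m") auto
        then show ?thesis
          by (metis finite_nat_set_iff_bounded_le)
      qed simp
      then show "openin Y {y \<in> topspace Y. x \<in> f y}" "closedin Y {y \<in> topspace Y. x \<in> f y}"
        unfolding eq using C by (auto intro!: openin_Union closedin_Union)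
    qed
    moreover have "B = {y \<in> topspace Y. f y \<in> monitorable_sets X}"
      unfolding B f_def monitorable_sets_def
      using monitorable_in_Union_layers_iff [OF S W meets] by simp
    ultimately show "\<exists>f. continuous_map Y (powerset_topology (topspace X)) f \<and>
        B = {y \<in> topspace Y. f y \<in> monitorable_sets X}"
      by blast
  qed
qed

end
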